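(* Let $\lambda:A^*\to\Lambda$ associate to each word $w$ the shape of the tableau $P(w)$. Then the left syntactic congruence $\equiv^l_\lambda$ (defined by $u\equiv^l_\lambda v$ iff $\lambda(xu)=\lambda(xv)$ for all $x\in A^*$) equals the plactic congruence $\equiv_{plax}$.
   Context: $A$ is a finite totally ordered alphabet, $\Lambda$ the set of integer partitions. $P(w)$ is the (semistandard Young) tableau obtained from $w$ by Schensted's insertion algorithm, and its shape is the integer partition formed by its row lengths. The plactic congruence is $u\equiv_{plax}v$ iff $P(u)=P(v)$; equivalently the congruence on $A^*$ generated by $bac\equiv bca$, $acb\equiv cab$ ($a<b<c$), $baa\equiv aba$, $bba\equiv bab$ ($a<b$). *)

theory Defs
  imports Main
begin

text \<open>A tableau is the list of its rows, read from the first (longest) row on. Row insertion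
  replaces the leftmost entry strictly greater than the inserted letter and returns the bumped
  entry; if there is no such entry, the letter is appended to the row and nothing is bumped.\<close>

fun row_insert :: "'a::linorder \<Rightarrow> 'a list \<Rightarrow> 'a list \<times> 'a option" where
  "row_insert x [] = ([x], None)"
| "row_insert x (y # ys) =
     (if x < y then (x # ys, Some y)
      else (case row_insert x ys of (zs, bumped) \<Rightarrow> (y # zs, bumped)))"

fun tableau_insert :: "'a::linorder \<Rightarrow> 'a list list \<Rightarrow> 'a list list" where
  "tableau_insert x [] = [[x]]"
| "tableau_insert x (r # rs) =
     (case row_insert x r of
        (r', None) \<Rightarrow> r' # rs
      | (r', Some y) \<Rightarrow> r' # tableau_insert y rs)"

text \<open>The letters of a word are inserted from left to right.\<close>

definition P_tableau :: "'a::linorder list \<Rightarrow> 'a list list" where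
  "P_tableau w = fold tableau_insert w []"

text \<open>Integer partitions are represented by the list of their parts in weakly decreasing order.\<close>

definition shape :: "'a list list \<Rightarrow> nat list" where
  "shape T = map length T"

definition lambda_shape :: "'a::linorder list \<Rightarrow> nat list" where
  "lambda_shape w = shape (P_tableau w)"

definition left_syntactic_congruence :: "'a set \<Rightarrow> ('a list \<Rightarrow> 'b) \<Rightarrow> 'a list rel" where
  "left_syntactic_congruence A f =
     {(u, v). u \<in> lists A \<and> v \<in> lists A \<and> (\<forall>x \<in> lists A. f (x @ u) = f (x @ v))}"

definition plactic_congruence :: "'a::linorder set \<Rightarrow> 'a list rel" where
  "plactic_congruence A = {(u, v). u \<in> lists A \<and> v \<in> lists A \<and> P_tableau u = P_tableau v}"

end

theory Submission
  imports Defs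
begin

text \<open>Row insertion turns a Knuth move on the inserted word into at most one Knuth move on the bumped
  word, so Knuth-equivalent words have the same tableau. Conversely every word is Knuth-equivalent
  to the reading word of its tableau. Hence the plactic congruence is a left congruence, and it
  refines the left syntactic one.

  For the other inclusion let \<open>n\<close> be the largest letter. For large \<open>m\<close> the tableau of \<open>n\<^sup>m w\<close> is
  obtained from that of the restriction \<open>w'\<close> of \<open>w\<close> to the letters below \<open>n\<close> by adding a letter
  \<open>n\<close> under each column and completing the first row with copies of \<open>n\<close>. Removing the first part
  of its shape leaves the shape of \<open>w'\<close>, so left syntactic congruence passes to the restrictions.
  By induction the restrictions have equal tableaux; the cells of \<open>n\<close> are then read off the
  shape.\<close>

section \<open>Row insertion of a single letter\<close>

lemma row_insert_length:
  "row_insert x r = (r', b) \<Longrightarrow> length r' = (if b = None then Suc (length r) else length r)"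
  by (induction r arbitrary: r') (auto split: if_splits prod.splits)

lemma row_insert_NoneD: "row_insert x r = (r', None) \<Longrightarrow> r' = r @ [x] \<and> (\<forall>z \<in> set r. z \<le> x)"
  by (induction r arbitrary: r') (auto split: if_splits prod.splits)

lemma row_insert_append_None:
  "row_insert x r = (r', None) \<Longrightarrow>
     row_insert x (r @ s) = (case row_insert x s of (s', b) \<Rightarrow> (r @ s', b))"
  by (induction r arbitrary: r') (auto split: if_splits prod.splits)

lemma row_insert_append_Some:
  "row_insert x r = (r', Some z) \<Longrightarrow> row_insert x (r @ s) = (r' @ s, Some z)"
  by (induction r arbitrary: r') (auto split: if_splits prod.splits)

lemma row_insert_eq_append: "\<forall>z \<in> set r. z \<le> x \<Longrightarrow> row_insert x r = (r @ [x], None)"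
  by (induction r) auto

lemma row_insert_bumped: "row_insert x r = (r', Some z) \<Longrightarrow> x < z \<and> z \<in> set r"
  by (induction r arbitrary: r') (auto split: if_splits prod.splits)

lemma row_insert_set: "row_insert x r = (r', b) \<Longrightarrow> set r' \<subseteq> insert x (set r) \<and> x \<in> set r'"
  by (induction r arbitrary: r') (auto split: if_splits prod.splits)

lemma row_insert_sorted: "row_insert x r = (r', b) \<Longrightarrow> sorted r \<Longrightarrow> sorted r'"
proof (induction r arbitrary: r')
  case (Cons y ys)
  show ?case
  proof (cases "x < y")
    case True
    then show ?thesis using Cons.prems by fastforce
  next
    case False
    obtain zs where zs: "row_insert x ys = (zs, b)" "r' = y # zs"
      using Cons.prems(1) False by (auto split: prod.splits)
    then show ?thesis using Cons False row_insert_set[OF zs(1)] by fastforce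
  qed
qed simp

text \<open>Everything up to the cell taken by \<open>x\<close> is at most \<open>x\<close>, hence
  at most \<open>y\<close>. So \<open>y\<close> acts strictly to the right, on a part of the sorted
  row that \<open>x\<close> has not touched.\<close>

lemma row_insert_mono:
  assumes "sorted r" "x \<le> y" "row_insert x r = (r', b)" "row_insert y r' = (r'', c)"
  shows "(b = None \<longrightarrow> c = None) \<and> (\<forall>p q. b = Some p \<longrightarrow> c = Some q \<longrightarrow> p \<le> q)"
  using assms
proof (induction r arbitrary: r' r'')
  case (Cons a r)
  show ?case
  proof (cases "x < a")
    case True
    then have "r' = x # r" "b = Some a" using Cons.prems by auto
    moreover obtain s where "row_insert y r = (s, c)"
      using Cons.prems calculation by (auto split: prod.splits if_splits)
    ultimately show ?thesis using Cons.prems(1) row_insert_bumped by fastforce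
  next
    case False
    then obtain s where s: "row_insert x r = (s, b)" "r' = a # s"
      using Cons.prems by (auto split: prod.splits)
    moreover have "\<not> y < a" using False Cons.prems by simp
    ultimately obtain t where "row_insert y s = (t, c)"
      using Cons.prems s(2) by (auto split: prod.splits)
    with s show ?thesis using Cons.IH[of s t] Cons.prems by simp
  qed
qed (auto split: if_splits)

lemma row_insert_smaller:
  assumes "sorted r" "y \<in> set r" "x < y"
  obtains r' z where "row_insert x r = (r', Some z)" "z \<le> y"
proof -
  have "\<exists>r' z. row_insert x r = (r', Some z) \<and> z \<le> y"
    using assms by (induction r) (auto split: prod.splits)
  then show thesis using that by blast
qed

section \<open>Insertion of words into a row, and Knuth moves\<close>

fun row_insert_word :: "'a::linorder list \<Rightarrow> 'a list \<Rightarrow> 'a list \<times> 'a list" where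
  "row_insert_word [] r = (r, [])"
| "row_insert_word (x # w) r =
     (case row_insert x r of (r', b) \<Rightarrow>
        (case row_insert_word w r' of (r'', bs) \<Rightarrow>
           (r'', case b of None \<Rightarrow> bs | Some y \<Rightarrow> y # bs)))"

lemma row_insert_word_Cons:
  "\<forall>x \<in> set w. a \<le> x \<Longrightarrow>
     row_insert_word w (a # r) = (case row_insert_word w r of (r', bs) \<Rightarrow> (a # r', bs))"
  by (induction w arbitrary: r) (auto split: prod.splits)

text \<open>The lower rows see only the bumped word, so invariance of the whole tableau reduces to a
  statement about one row.\<close>

lemma fold_tableau_insert_Cons:
  "fold tableau_insert w (r # rs) =
     (case row_insert_word w r of (r', bs) \<Rightarrow> r' # fold tableau_insert bs rs)"
  by (induction w arbitrary: r rs) (auto split: prod.splits option.splits)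

text \<open>The weak inequalities merge the four plactic relations into two: \<open>y = z\<close> in
  \<open>knuth1\<close> gives bba = bab, and \<open>x = y\<close> in \<open>knuth2\<close> gives aba
  = baa.\<close>

inductive knuth :: "'a::linorder list \<Rightarrow> 'a list \<Rightarrow> bool" where
  knuth1: "x < y \<Longrightarrow> y \<le> z \<Longrightarrow> knuth [y, z, x] [y, x, z]"
| knuth2: "x \<le> y \<Longrightarrow> y < z \<Longrightarrow> knuth [x, z, y] [z, x, y]"

abbreviation knuth_eq :: "'a::linorder list \<Rightarrow> 'a list \<Rightarrow> bool" where
  "knuth_eq u v \<equiv> u = v \<or> knuth u v"

text \<open>A head \<open>a\<close> with \<open>a <= x\<close> stays put. If
  \<open>x < a <= y\<close>, then \<open>x\<close> bumps \<open>a\<close> while \<open>y\<close> and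
  \<open>z\<close> act on the tail, bumping \<open>[p, q, a]\<close> against
  \<open>[p, a, q]\<close>. If \<open>y < a\<close>, then \<open>y\<close> bumps \<open>a\<close>
  and \<open>x\<close> bumps \<open>y\<close>, giving \<open>[a, q, y]\<close> against
  \<open>[a, y, q]\<close>. The bumped words coincide when \<open>z\<close> bumps nothing.\<close>

lemma row_insert_word_knuth1:
  assumes "sorted r" "x < y" "y \<le> z"
  shows "\<exists>r' b c. row_insert_word [y, z, x] r = (r', b) \<and> row_insert_word [y, x, z] r = (r', c)
           \<and> knuth_eq b c"
  using assms
proof (induction r)
  case Nil
  then show ?case by auto
next
  case (Cons a r)
  consider "a \<le> x" | "x < a" "a \<le> y" | "y < a" by fastforce
  then show ?case
  proof cases
    case 1
    then have "\<forall>w \<in> set [x, y, z]. a \<le> w" using Cons.prems by auto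
    then have "row_insert_word [y, z, x] (a # r) = (case row_insert_word [y, z, x] r of (r', bs) \<Rightarrow> (a # r', bs))"
      "row_insert_word [y, x, z] (a # r) = (case row_insert_word [y, x, z] r of (r', bs) \<Rightarrow> (a # r', bs))"
      by (intro row_insert_word_Cons; simp)+
    moreover obtain r' b c where "row_insert_word [y, z, x] r = (r', b)"
        "row_insert_word [y, x, z] r = (r', c)" "knuth_eq b c"
      using Cons by auto
    ultimately show ?thesis by (simp del: row_insert_word.simps)
  next
    case 2
    obtain s b where s: "row_insert y r = (s, b)" by fastforce
    obtain t c where t: "row_insert z s = (t, c)" by fastforce
    have m: "(b = None \<longrightarrow> c = None) \<and> (\<forall>p q. b = Some p \<longrightarrow> c = Some q \<longrightarrow> p \<le> q)"
      using row_insert_mono[OF _ _ s t] Cons.prems by auto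
    have bb: "b = Some p \<Longrightarrow> a < p" for p
      using row_insert_bumped s 2 by fastforce
    show ?thesis
    proof (cases b)
      case None
      then show ?thesis using 2 Cons.prems s t m by auto
    next
      case (Some p)
      then have "knuth [p, q, a] [p, a, q]" if "c = Some q" for q
        using that m bb by (auto intro: knuth1)
      then show ?thesis using 2 Cons.prems s t Some by (cases c) auto
    qed
  next
    case 3
    obtain t c where t: "row_insert z r = (t, c)" by fastforce
    have "c = Some q \<Longrightarrow> a \<le> q" for q
      using row_insert_bumped t Cons.prems by fastforce
    then have "knuth [a, q, y] [a, y, q]" if "c = Some q" for q
      using that 3 by (auto intro: knuth1)
    then show ?thesis using 3 Cons.prems t by (cases c) auto
  qed
qed

text \<open>The same case analysis on the head \<open>a\<close>. For \<open>x < a <= z\<close> the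
  bumped words differ by a move of the second kind, but for \<open>z < a\<close> by one of the first
  kind; \<open>knuth_eq\<close> therefore has to allow both.\<close>

lemma row_insert_word_knuth2:
  assumes "sorted r" "x \<le> y" "y < z"
  shows "\<exists>r' b c. row_insert_word [x, z, y] r = (r', b) \<and> row_insert_word [z, x, y] r = (r', c)
           \<and> knuth_eq b c"
  using assms
proof (induction r)
  case Nil
  then show ?case by auto
next
  case (Cons a r)
  consider "a \<le> x" | "x < a" "a \<le> z" | "z < a" by fastforce
  then show ?case
  proof cases
    case 1
    then have "\<forall>w \<in> set [x, y, z]. a \<le> w" using Cons.prems by auto
    then have "row_insert_word [x, z, y] (a # r) = (case row_insert_word [x, z, y] r of (r', bs) \<Rightarrow> (a # r', bs))"
      "row_insert_word [z, x, y] (a # r) = (case row_insert_word [z, x, y] r of (r', bs) \<Rightarrow> (a # r', bs))"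
      by (intro row_insert_word_Cons; simp)+
    moreover obtain r' b c where "row_insert_word [x, z, y] r = (r', b)"
        "row_insert_word [z, x, y] r = (r', c)" "knuth_eq b c"
      using Cons by auto
    ultimately show ?thesis by (simp del: row_insert_word.simps)
  next
    case 2
    obtain s b where s: "row_insert z r = (s, b)" by fastforce
    \<comment> \<open>Once \<open>z\<close> is in the row, the smaller \<open>y\<close> must bump
      some \<open>c <= z\<close>, whereas a letter bumped by \<open>z\<close> exceeds
      \<open>z\<close>.\<close>
    have "sorted s" "z \<in> set s"
      using row_insert_sorted[OF s] row_insert_set[OF s] Cons.prems by auto
    then obtain t c where t: "row_insert y s = (t, Some c)" "c \<le> z"
      using row_insert_smaller Cons.prems by metis
    have "a \<le> c"
      using row_insert_bumped[OF t(1)] row_insert_set[OF s] Cons.prems 2 by auto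
    moreover have "b = Some q \<Longrightarrow> c < q" for q
      using row_insert_bumped s t by fastforce
    ultimately have "knuth [a, q, c] [q, a, c]" if "b = Some q" for q
      using that by (auto intro: knuth2)
    then show ?thesis using 2 Cons.prems s t by (cases b) auto
  next
    case 3
    \<comment> \<open>Here \<open>z\<close> is below every entry, so it would bump the head of the
      tail. In one order it does so and is then displaced by \<open>y\<close>; in the other it sits
      in the first cell, is displaced by \<open>x\<close>, and \<open>y\<close> bumps that
      head.\<close>
    have e: "row_insert z r = (z # tl r, if r = [] then None else Some (hd r))"
      using 3 Cons.prems by (cases r) auto
    have "knuth [a, hd r, z] [a, z, hd r]" if "r \<noteq> []"
      using that 3 Cons.prems by (cases r) (auto intro: knuth1)
    then show ?thesis using 3 Cons.prems e by (cases r) auto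
  qed
qed

text \<open>The words vary in the induction on the rows: after one row the bumped words are again
  equal or one Knuth move apart.\<close>

lemma fold_tableau_insert_knuth:
  assumes "knuth_eq u v" "\<forall>r \<in> set T. sorted r"
  shows "fold tableau_insert u T = fold tableau_insert v T"
  using assms
proof (induction T arbitrary: u v)
  case Nil
  then show ?case by (auto elim!: knuth.cases)
next
  case (Cons r T)
  have "\<exists>r' b c. row_insert_word u r = (r', b) \<and> row_insert_word v r = (r', c) \<and> knuth_eq b c"
  proof (cases "u = v")
    case True
    then show ?thesis by (cases "row_insert_word u r") auto
  next
    case False
    then have "knuth u v" using Cons.prems by auto
    then show ?thesis
    proof cases
      case (knuth1 x y z)
      then show ?thesis using row_insert_word_knuth1[of r x y z] Cons.prems(2) by simp
    next
      case (knuth2 x y z)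
      then show ?thesis using row_insert_word_knuth2[of r x y z] Cons.prems(2) by simp
    qed
  qed
  then obtain r' b c where "row_insert_word u r = (r', b)" "row_insert_word v r = (r', c)"
    and bc: "knuth_eq b c" by blast
  moreover have "fold tableau_insert b T = fold tableau_insert c T"
    using Cons.IH[OF bc] Cons.prems(2) by simp
  ultimately show ?case by (simp add: fold_tableau_insert_Cons)
qed

lemma tableau_insert_sorted:
  "\<forall>r \<in> set T. sorted r \<Longrightarrow> \<forall>r \<in> set (tableau_insert x T). sorted r"
  by (induction x T rule: tableau_insert.induct)
    (auto split: prod.splits option.splits dest: row_insert_sorted[OF sym])

lemma P_tableau_snoc: "P_tableau (w @ [x]) = tableau_insert x (P_tableau w)"
  by (simp add: P_tableau_def)

lemma P_tableau_sorted: "\<forall>r \<in> set (P_tableau w). sorted r"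
  by (induction w rule: rev_induct) (use tableau_insert_sorted in \<open>auto simp: P_tableau_snoc P_tableau_def\<close>)

section \<open>The congruence generated by Knuth moves, and reading words\<close>

inductive plactic :: "'a::linorder list \<Rightarrow> 'a list \<Rightarrow> bool" where
  plactic_refl: "plactic w w"
| plactic_sym: "plactic u v \<Longrightarrow> plactic v u"
| plactic_trans: "plactic u v \<Longrightarrow> plactic v w \<Longrightarrow> plactic u w"
| plactic_knuth: "knuth u v \<Longrightarrow> plactic (p @ u @ q) (p @ v @ q)"

lemma plactic_append: "plactic u v \<Longrightarrow> plactic (p @ u @ q) (p @ v @ q)"
proof (induction rule: plactic.induct)
  case (plactic_knuth u v p' q')
  then show ?case using plactic.plactic_knuth[of u v "p @ p'" "q' @ q"] by simp
qed (auto intro: plactic.intros)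

lemma plactic_Cons: "plactic u v \<Longrightarrow> plactic (x # u) (x # v)"
  using plactic_append[of u v "[x]" "[]"] by simp

lemma plactic_P_tableau: "plactic u v \<Longrightarrow> P_tableau u = P_tableau v"
proof (induction rule: plactic.induct)
  case (plactic_knuth u v p q)
  then have "fold tableau_insert u (P_tableau p) = fold tableau_insert v (P_tableau p)"
    using P_tableau_sorted by (intro fold_tableau_insert_knuth) auto
  then show ?case by (simp add: P_tableau_def)
qed auto

text \<open>Bumping is a chain of Knuth moves: \<open>x\<close> travels left through the entries
  behind the bumped \<open>y\<close> by moves of the first kind, then \<open>y\<close> travels to
  the front by moves of the second kind.\<close>

lemma row_insert_plactic:
  "row_insert x r = (r', Some y) \<Longrightarrow> sorted r \<Longrightarrow> plactic (r @ [x]) (y # r')"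
proof (induction r arbitrary: r')
  case (Cons a r)
  show ?case
  proof (cases "x < a")
    case True
    have "sorted s \<Longrightarrow> \<forall>b \<in> set s. a \<le> b \<Longrightarrow> plactic (a # s @ [x]) (a # x # s)" for s
    proof (induction s rule: rev_induct)
      case (snoc b s)
      \<comment> \<open>The left neighbour of \<open>b\<close>; it serves as the witness of the
        move, since \<open>x < a <= ?l <= b\<close>.\<close>
      let ?l = "last (a # s)"
      have "knuth [?l, b, x] [?l, x, b]"
        using True snoc.prems by (intro knuth1) (auto simp: sorted_append intro: less_le_trans)
      then have "plactic (butlast (a # s) @ [?l, b, x] @ []) (butlast (a # s) @ [?l, x, b] @ [])"
        by (rule plactic_knuth)
      then have "plactic (a # s @ [b, x]) (a # s @ [x, b])"
        using append_butlast_last_id[of "a # s"]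
        by (metis append.assoc append_Cons append_Nil append_Nil2 list.distinct(1))
      moreover have "plactic (a # s @ [x, b]) (a # x # s @ [b])"
        using snoc plactic_append[of "a # s @ [x]" "a # x # s" "[]" "[b]"]
        by (auto simp: sorted_append)
      ultimately show ?case by (auto intro: plactic_trans)
    qed (simp add: plactic_refl)
    then show ?thesis using True Cons.prems by auto
  next
    case False
    then obtain s where s: "row_insert x r = (s, Some y)" "r' = a # s"
      using Cons.prems by (auto split: prod.splits)
    then have "plactic (a # r @ [x]) (a # y # s)"
      using Cons by (auto intro: plactic_Cons)
    moreover have "plactic (a # y # s) (y # a # s)"
    proof (cases s)
      case Nil
      then show ?thesis using row_insert_set[OF s(1)] by simp
    next
      case (Cons h t)
      \<comment> \<open>The head \<open>h\<close> of the row after the insertion is the witness for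
        exchanging \<open>a\<close> and \<open>y\<close>: \<open>a <= h <= x < y\<close>.\<close>
      have "a \<le> h"
        using row_insert_set[OF s(1)] Cons False \<open>sorted (a # r)\<close> by auto
      moreover have "sorted s" using row_insert_sorted[OF s(1)] \<open>sorted (a # r)\<close> by simp
      then have "h \<le> x" using row_insert_set[OF s(1)] Cons by auto
      then have "h < y" using row_insert_bumped[OF s(1)] by auto
      ultimately have "plactic ([] @ [a, y, h] @ t) ([] @ [y, a, h] @ t)"
        by (intro plactic_knuth knuth2)
      then show ?thesis using Cons by simp
    qed
    ultimately show ?thesis using s(2) plactic_trans by auto
  qed
qed simp

text \<open>\<open>concat (rev T)\<close> reads the rows from the last to the first. Moving the
  bumped letter to the front of its row puts it right behind the word of the lower rows, where the
  induction takes over.\<close>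

lemma tableau_insert_plactic:
  "\<forall>r \<in> set T. sorted r \<Longrightarrow> plactic (concat (rev T) @ [x]) (concat (rev (tableau_insert x T)))"
proof (induction T arbitrary: x)
  case (Cons r T)
  obtain r' b where r': "row_insert x r = (r', b)" by fastforce
  show ?case
  proof (cases b)
    case None
    then show ?thesis using r' row_insert_NoneD by (auto intro: plactic_refl)
  next
    case (Some y)
    then have "plactic (concat (rev T) @ (r @ [x]) @ []) (concat (rev T) @ (y # r') @ [])"
      using r' Cons.prems by (intro plactic_append row_insert_plactic) auto
    moreover have "plactic ([] @ (concat (rev T) @ [y]) @ r')
        ([] @ concat (rev (tableau_insert y T)) @ r')"
      using Cons by (intro plactic_append) auto
    ultimately show ?thesis using r' Some by (auto intro: plactic_trans)
  qed
qed (simp add: plactic_refl)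

lemma plactic_reading_word: "plactic w (concat (rev (P_tableau w)))"
proof (induction w rule: rev_induct)
  case (snoc x w)
  have "plactic ([] @ w @ [x]) ([] @ concat (rev (P_tableau w)) @ [x])"
    using snoc by (rule plactic_append)
  then show ?case
    using tableau_insert_plactic[OF P_tableau_sorted, of w x]
    by (auto simp: P_tableau_snoc intro: plactic_trans)
qed (simp add: plactic_refl P_tableau_def)

text \<open>Both words are plactically equivalent to their common reading word, and Knuth moves
  remain available behind the prefix \<open>x\<close>.\<close>

lemma P_tableau_append_left:
  assumes "P_tableau u = P_tableau v"
  shows "P_tableau (x @ u) = P_tableau (x @ v)"
proof -
  have "plactic u v"
    using assms plactic_reading_word[of u] plactic_reading_word[of v]
    by (auto intro: plactic_trans plactic_sym)
  then show ?thesis using plactic_append[of u v x "[]"] plactic_P_tableau by auto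
qed

section \<open>Column strictness and size bounds\<close>

fun top_row :: "'a list list \<Rightarrow> 'a list" where
  "top_row [] = []"
| "top_row (r # rs) = r"

fun above :: "'a::linorder list \<Rightarrow> 'a list \<Rightarrow> bool" where
  "above r [] \<longleftrightarrow> True"
| "above [] (b # s) \<longleftrightarrow> False"
| "above (a # r) (b # s) \<longleftrightarrow> a < b \<and> above r s"

fun column_strict :: "'a::linorder list list \<Rightarrow> bool" where
  "column_strict [] \<longleftrightarrow> True"
| "column_strict (r # rs) \<longleftrightarrow> above r (top_row rs) \<and> column_strict rs"

lemma above_length: "above r s \<Longrightarrow> length s \<le> length r"
  by (induction r s rule: above.induct) auto

lemma above_append: "above r s \<Longrightarrow> above (r @ t) s"
  by (induction r s rule: above.induct) auto

lemma row_insert_above: "above r s \<Longrightarrow> row_insert x r = (r', Some y) \<Longrightarrow> above r' s"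
  by (induction r s arbitrary: r' rule: above.induct) (auto split: if_splits prod.splits)

text \<open>The entry below \<open>y\<close>, if there is one, exceeds \<open>y\<close>, so
  \<open>y\<close> lands weakly to the left of the column it left. In \<open>r'\<close> the entries
  up to that column are at most \<open>x\<close>, hence below \<open>y\<close>.\<close>

lemma row_insert_above_row_insert:
  "above r s \<Longrightarrow> row_insert x r = (r', Some y) \<Longrightarrow> above r' (fst (row_insert y s))"
proof (induction r s arbitrary: r' rule: above.induct)
  case (1 r)
  then show ?case using row_insert_set[OF 1(2)] row_insert_bumped[OF 1(2)]
    by (cases r) (auto split: if_splits prod.splits)
next
  case (3 a r b s)
  then show ?case
    using row_insert_above[of r s x] row_insert_bumped[of x r]
    by (fastforce split: if_splits prod.splits)
qed simp

lemma top_row_tableau_insert: "top_row (tableau_insert x T) = fst (row_insert x (top_row T))"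
  by (cases T) (auto split: prod.splits option.splits)

lemma tableau_insert_column_strict: "column_strict T \<Longrightarrow> column_strict (tableau_insert x T)"
proof (induction T arbitrary: x)
  case (Cons r T)
  obtain r' b where r': "row_insert x r = (r', b)" by fastforce
  then show ?case
    using Cons row_insert_NoneD[of x r r'] row_insert_above_row_insert[of r "top_row T" x r']
    by (cases b) (auto simp: top_row_tableau_insert above_append)
qed simp

lemma P_tableau_column_strict: "column_strict (P_tableau w)"
  by (induction w rule: rev_induct)
    (auto simp: P_tableau_snoc tableau_insert_column_strict, simp add: P_tableau_def)

lemma tableau_insert_entries:
  "\<forall>r \<in> set T. set r \<subseteq> B \<Longrightarrow> x \<in> B \<Longrightarrow> \<forall>r \<in> set (tableau_insert x T). set r \<subseteq> B"
proof (induction T arbitrary: x)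
  case (Cons r T)
  obtain r' b where r': "row_insert x r = (r', b)" by fastforce
  have "set r' \<subseteq> B" using row_insert_set[OF r'] Cons.prems by auto
  moreover have "b = Some y \<Longrightarrow> y \<in> B" for y
    using row_insert_bumped[of x r r' y] r' Cons.prems by auto
  ultimately show ?case using r' Cons by (cases b) auto
qed simp

lemma P_tableau_entries: "\<forall>r \<in> set (P_tableau w). set r \<subseteq> set w"
proof (induction w rule: rev_induct)
  case (snoc x w)
  then have "\<forall>r \<in> set (P_tableau w). set r \<subseteq> set (w @ [x])" by auto
  then show ?case
    using tableau_insert_entries[of "P_tableau w" "set (w @ [x])" x] by (simp add: P_tableau_snoc)
qed (simp add: P_tableau_def)

lemma tableau_insert_nonempty:
  "\<forall>r \<in> set T. r \<noteq> [] \<Longrightarrow> \<forall>r \<in> set (tableau_insert x T). r \<noteq> []"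
proof (induction T arbitrary: x)
  case (Cons r T)
  obtain r' b where r': "row_insert x r = (r', b)" by fastforce
  then show ?case using Cons row_insert_set[OF r'] by (cases b) auto
qed simp

lemma P_tableau_nonempty: "\<forall>r \<in> set (P_tableau w). r \<noteq> []"
  by (induction w rule: rev_induct) (use tableau_insert_nonempty in \<open>auto simp: P_tableau_snoc P_tableau_def\<close>)

lemma length_top_row: "length (top_row (P_tableau w)) \<le> length w"
proof (induction w rule: rev_induct)
  case (snoc x w)
  obtain r' b where r': "row_insert x (top_row (P_tableau w)) = (r', b)" by fastforce
  then show ?case
    using snoc row_insert_length[OF r']
    by (auto simp: P_tableau_snoc top_row_tableau_insert split: if_splits)
qed (simp add: P_tableau_def)

section \<open>Prepending many copies of the largest letter\<close>

text \<open>Every column of the given tableau, and \<open>m\<close> columns in total, receives one letter \<open>n\<close>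
  at its bottom.\<close>

fun extend_columns :: "'a \<Rightarrow> nat \<Rightarrow> 'a list list \<Rightarrow> 'a list list" where
  "extend_columns n m [] = (if m = 0 then [] else [replicate m n])"
| "extend_columns n m (r # rs) =
     (r @ replicate (m - length r) n) # extend_columns n (length r) rs"

text \<open>Each row is filled up to the length of the row before it, the first one to
  \<open>m\<close>, and the last row gets a row of its own length beneath it. Column strictness
  makes the lengths weakly decrease, so the subtractions are exact.\<close>

lemma shape_extend_columns:
  assumes "column_strict T" "length (top_row T) \<le> m" "0 < m" "\<forall>r \<in> set T. r \<noteq> []"
  shows "shape (extend_columns n m T) = m # shape T"
  using assms
proof (induction T arbitrary: m)
  case (Cons r T)
  then show ?case using above_length[of r "top_row T"] by (auto simp: shape_def)
qed (simp add: shape_def)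

lemma extend_columns_insert_max:
  assumes "\<forall>r \<in> set T. \<forall>z \<in> set r. z < n" "length (top_row T) \<le> m"
  shows "tableau_insert n (extend_columns n m T) = extend_columns n (Suc m) T"
proof (cases T)
  case (Cons r rs)
  then have "row_insert n (r @ replicate (m - length r) n) = (r @ replicate (m - length r) n @ [n], None)"
    using assms by (subst row_insert_eq_append) auto
  then show ?thesis using Cons assms by (simp add: Suc_diff_le replicate_append_same)
qed (auto simp: row_insert_eq_append replicate_append_same)

text \<open>If \<open>y\<close> bumps a letter of \<open>r\<close>, the padding of that row is
  untouched. If \<open>y\<close> would be appended to \<open>r\<close>, it bumps the first padding
  letter \<open>n\<close> instead, which drops to the bottom of the column that \<open>y\<close>
  opens.\<close>

lemma extend_columns_insert:
  assumes "\<forall>r \<in> set T. \<forall>z \<in> set r. z < n" "y < n" "column_strict T"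
    "length (top_row (tableau_insert y T)) \<le> m"
  shows "tableau_insert y (extend_columns n m T) = extend_columns n m (tableau_insert y T)"
  using assms
proof (induction T arbitrary: y m)
  case Nil
  then show ?case by (cases m) auto
next
  case (Cons r T)
  obtain r' b where r': "row_insert y r = (r', b)" by fastforce
  show ?case
  proof (cases b)
    case None
    then have e: "r' = r @ [y]" using r' row_insert_NoneD by auto
    \<comment> \<open>The bound on the new first row guarantees a padding letter for
      \<open>y\<close> to bump.\<close>
    then obtain k where k: "m - length r = Suc k" "m - length r' = k"
      using Cons.prems None r' by (cases "m - length r") auto
    have "tableau_insert n (extend_columns n (length r) T) = extend_columns n (Suc (length r)) T"
      using Cons.prems above_length by (intro extend_columns_insert_max) auto
    then show ?thesis using r' None e k Cons.prems row_insert_append_None[of y r r'] by simp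
  next
    case (Some z)
    have l: "length r' = length r" using row_insert_length[OF r'] Some by simp
    have "z < n" using row_insert_bumped r' Some Cons.prems(1) by fastforce
    \<comment> \<open>Column strictness after the insertion supplies the length bound for the rows
      below.\<close>
    moreover have "above r' (top_row (tableau_insert z T))"
      using row_insert_above_row_insert r' Some Cons.prems by (auto simp: top_row_tableau_insert)
    then have "length (top_row (tableau_insert z T)) \<le> length r"
      using above_length l by metis
    ultimately have "tableau_insert z (extend_columns n (length r) T)
        = extend_columns n (length r) (tableau_insert z T)"
      using Cons.prems by (intro Cons.IH) auto
    then show ?thesis using r' Some l row_insert_append_Some[of y r r' z] by simp
  qed
qed

text \<open>Each letter below \<open>n\<close> uses up at most one padding letter of the first row,
  so \<open>m >= length w\<close> copies suffice; each \<open>n\<close> in \<open>w\<close>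
  lengthens that row by one.\<close>

lemma P_tableau_replicate_append:
  assumes "set w \<subseteq> {..n}" "length w \<le> m"
  shows "P_tableau (replicate m n @ w) =
    extend_columns n (m + count_list w n) (P_tableau (filter (\<lambda>z. z < n) w))"
  using assms
proof (induction w rule: rev_induct)
  case Nil
  have "P_tableau (replicate m n) = extend_columns n m []"
  proof (induction m)
    case (Suc m)
    have "P_tableau (replicate (Suc m) n) = tableau_insert n (P_tableau (replicate m n))"
      by (metis P_tableau_snoc replicate_Suc replicate_append_same)
    then show ?case
      using Suc extend_columns_insert_max[of "[]" n m] by simp
  qed (simp add: P_tableau_def)
  then show ?case by (simp add: P_tableau_def)
next
  case (snoc x w)
  let ?f = "filter (\<lambda>z. z < n)"
  let ?T = "P_tableau (?f w)"
  have IH: "P_tableau (replicate m n @ w) = extend_columns n (m + count_list w n) ?T"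
    using snoc by auto
  have T: "\<forall>r \<in> set ?T. \<forall>z \<in> set r. z < n" using P_tableau_entries[of "?f w"] by auto
  have l: "length (?f w) < m"
    using snoc.prems(2) le_less_trans[OF length_filter_le[of "\<lambda>z. z < n" w]] by simp
  have "P_tableau (replicate m n @ w @ [x]) = tableau_insert x (extend_columns n (m + count_list w n) ?T)"
    using IH P_tableau_snoc[of "replicate m n @ w" x] by simp
  also have "\<dots> = extend_columns n (m + count_list (w @ [x]) n) (P_tableau (?f (w @ [x])))"
  proof (cases "x < n")
    case True
    have "length (top_row (P_tableau (?f w @ [x]))) \<le> m + count_list w n"
      using length_top_row[of "?f w @ [x]"] l by simp
    then have "tableau_insert x (extend_columns n (m + count_list w n) ?T) =
        extend_columns n (m + count_list w n) (tableau_insert x ?T)"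
      using T True P_tableau_column_strict
      by (intro extend_columns_insert) (auto simp only: P_tableau_snoc)
    moreover have "count_list (w @ [x]) n = count_list w n" using True by simp
    ultimately show ?thesis using True by (simp add: P_tableau_snoc)
  next
    case False
    then have "x = n" using snoc.prems by auto
    moreover have "length (top_row ?T) \<le> m + count_list w n"
      using length_top_row[of "?f w"] l by simp
    ultimately show ?thesis using extend_columns_insert_max[OF T] by simp
  qed
  finally show ?case .
qed

section \<open>Restriction of tableaux to the letters below \<open>n\<close>\<close>

text \<open>The letters below \<open>n\<close> form a prefix of a sorted row. If
  \<open>y < n\<close> bumps a letter outside that prefix, it is appended to the restricted
  row.\<close>

lemma row_insert_filter:
  assumes "sorted r" "row_insert y r = (r', b)"
  shows "y < n \<Longrightarrow> row_insert y (filter (\<lambda>z. z < n) r) =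
      (filter (\<lambda>z. z < n) r', case b of None \<Rightarrow> None | Some z \<Rightarrow> if z < n then Some z else None)"
    and "\<not> y < n \<Longrightarrow> filter (\<lambda>z. z < n) r' = filter (\<lambda>z. z < n) r"
proof -
  have e: "filter (\<lambda>z. z < n) s = []" if "sorted (a # s)" "\<not> a < n" for a :: 'a and s
    using that by (auto simp: filter_empty_conv)
  show "row_insert y (filter (\<lambda>z. z < n) r) =
      (filter (\<lambda>z. z < n) r', case b of None \<Rightarrow> None | Some z \<Rightarrow> if z < n then Some z else None)"
    if "y < n"
    using that assms by (induction r arbitrary: r') (auto simp: e split: prod.splits if_splits)
  show "filter (\<lambda>z. z < n) r' = filter (\<lambda>z. z < n) r" if "\<not> y < n"
    using that assms by (induction r arbitrary: r') (auto split: prod.splits if_splits)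
qed

text \<open>Bumped letters only grow, so the whole bumping route lies outside the restriction;
  \<open>k\<close> counts a possible new row, which restricts to \<open>[]\<close>.\<close>

lemma tableau_insert_filter_ge:
  assumes "\<forall>r \<in> set T. sorted r" "\<not> y < n"
  shows "\<exists>k. map (filter (\<lambda>z. z < n)) (tableau_insert y T) =
    map (filter (\<lambda>z. z < n)) T @ replicate k []"
  using assms
proof (induction T arbitrary: y)
  case Nil
  then show ?case by (auto intro: exI[of _ 1])
next
  case (Cons r T)
  obtain r' b where r': "row_insert y r = (r', b)" by fastforce
  then have f: "filter (\<lambda>z. z < n) r' = filter (\<lambda>z. z < n) r"
    using row_insert_filter(2) Cons.prems by (metis list.set_intros(1))
  show ?case
  proof (cases b)
    case (Some z)
    then have "\<not> z < n" using row_insert_bumped r' Cons.prems by fastforce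
    then show ?thesis using Cons r' Some f by auto
  qed (use r' f in \<open>auto intro: exI[of _ 0]\<close>)
qed

lemma tableau_insert_filter:
  assumes "\<forall>r \<in> set T. sorted r" "y < n" "map (filter (\<lambda>z. z < n)) T = S @ replicate k []"
  shows "\<exists>k. map (filter (\<lambda>z. z < n)) (tableau_insert y T) = tableau_insert y S @ replicate k []"
  using assms
proof (induction T arbitrary: y S k)
  case Nil
  then show ?case by (auto intro: exI[of _ 0])
next
  case (Cons r T)
  obtain r' b where r': "row_insert y r = (r', b)" by fastforce
  let ?f = "filter (\<lambda>z. z < n)"
  have f: "row_insert y (?f r) =
      (?f r', case b of None \<Rightarrow> None | Some z \<Rightarrow> if z < n then Some z else None)"
    using row_insert_filter(1)[OF _ r'] Cons.prems by auto
  \<comment> \<open>If \<open>S\<close> is empty, the restriction of \<open>r\<close> is one of the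
    padding rows \<open>[]\<close>, and inserting into \<open>[[]]\<close> gives the same as
    inserting into \<open>[]\<close>.\<close>
  obtain S' k' where S': "map ?f T = S' @ replicate k' []"
      "tableau_insert y S = tableau_insert y (?f r # S')"
  proof (cases S)
    case Nil
    then show thesis using Cons.prems(3) that[of "[]" "k - 1"] by (cases k) auto
  next
    case (Cons s S')
    then show thesis using \<open>map ?f (r # T) = _\<close> that[of S' k] by simp
  qed
  show ?case
  proof (cases b)
    case None
    then show ?thesis using r' f S' by auto
  next
    case (Some z)
    show ?thesis
    proof (cases "z < n")
      case True
      then show ?thesis using Cons.IH[OF _ True S'(1)] Cons.prems r' f S' Some by auto
    next
      case False
      then obtain j where "map ?f (tableau_insert z T) = map ?f T @ replicate j []"
        using tableau_insert_filter_ge Cons.prems by (metis list.set_intros(2))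
      then show ?thesis using S' False Some f r' by (auto simp: replicate_add[symmetric])
    qed
  qed
qed

lemma P_tableau_filter:
  "\<exists>k. map (filter (\<lambda>z. z < n)) (P_tableau w) = P_tableau (filter (\<lambda>z. z < n) w) @ replicate k []"
proof (induction w rule: rev_induct)
  case Nil
  then show ?case by (simp add: P_tableau_def)
next
  case (snoc x w)
  then obtain k where k: "map (filter (\<lambda>z. z < n)) (P_tableau w) =
      P_tableau (filter (\<lambda>z. z < n) w) @ replicate k []" by blast
  show ?case
  proof (cases "x < n")
    case True
    then show ?thesis using tableau_insert_filter[OF P_tableau_sorted True k] by (simp add: P_tableau_snoc)
  next
    case False
    then show ?thesis using tableau_insert_filter_ge[OF P_tableau_sorted False, of w] k
      by (auto simp: P_tableau_snoc replicate_add[symmetric])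
  qed
qed

lemma sorted_filter_less:
  "sorted r \<Longrightarrow> set r \<subseteq> {..n} \<Longrightarrow>
     r = filter (\<lambda>z. z < n) r @ replicate (length r - length (filter (\<lambda>z. z < n) r)) n"
proof (induction r)
  case (Cons a r)
  show ?case
  proof (cases "a < n")
    case False
    then have "\<forall>z \<in> set (a # r). z = n" using Cons.prems by force
    then show ?thesis by (metis filter_False append_Nil diff_zero less_irrefl list.size(3)
        replicate_length_same)
  qed (use Cons in auto)
qed simp

lemma P_tableau_eqI:
  assumes "set u \<subseteq> {..n}" "set v \<subseteq> {..n}" "lambda_shape u = lambda_shape v"
    and "P_tableau (filter (\<lambda>z. z < n) u) = P_tableau (filter (\<lambda>z. z < n) v)"
  shows "P_tableau u = P_tableau v"
proof -
  let ?f = "filter (\<lambda>z. z < n)"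
  obtain j k where jk: "map ?f (P_tableau u) = P_tableau (?f u) @ replicate j []"
      "map ?f (P_tableau v) = P_tableau (?f v) @ replicate k []"
    using P_tableau_filter by metis
  have len: "map length (P_tableau u) = map length (P_tableau v)"
    using assms by (simp add: lambda_shape_def shape_def)
  then have "length (P_tableau u) = length (P_tableau v)" by (metis length_map)
  \<comment> \<open>Equal shapes have equally many rows, so equally many rows restrict to
    \<open>[]\<close> beyond the common tableau.\<close>
  then have "j = k" using jk assms(4)
    by (metis add_left_cancel length_append length_map length_replicate)
  then have eq: "map ?f (P_tableau u) = map ?f (P_tableau v)" using jk assms by simp
  show ?thesis
  proof (rule nth_equalityI)
    fix i assume i: "i < length (P_tableau u)"
    have i': "i < length (P_tableau v)" using i \<open>length (P_tableau u) = _\<close> by simp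
    have "length (P_tableau u ! i) = length (P_tableau v ! i)"
      using len i i' by (metis nth_map)
    moreover have "?f (P_tableau u ! i) = ?f (P_tableau v ! i)"
      using eq i i' by (metis nth_map)
    \<comment> \<open>A sorted row with entries up to \<open>n\<close> is its part below
      \<open>n\<close> followed by copies of \<open>n\<close>; its length and its restriction
      determine it.\<close>
    moreover have
      "w ! i = ?f (w ! i) @ replicate (length (w ! i) - length (?f (w ! i))) n"
      if "w = P_tableau x" "set x \<subseteq> {..n}" "i < length w" for w x
    proof (rule sorted_filter_less)
      have "w ! i \<in> set (P_tableau x)" using that by auto
      then show "sorted (w ! i)" "set (w ! i) \<subseteq> {..n}"
        using P_tableau_sorted[of x] P_tableau_entries[of x] that by blast+
    qed
    ultimately show "P_tableau u ! i = P_tableau v ! i"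
      using assms(1,2) i i' by metis
  qed fact
qed

section \<open>Induction on the alphabet, adding a new largest letter\<close>

lemma left_syntactic_P_tableau:
  assumes "finite A" "u \<in> lists A" "v \<in> lists A"
    and "\<And>x. x \<in> lists A \<Longrightarrow> lambda_shape (x @ u) = lambda_shape (x @ v)"
  shows "P_tableau u = P_tableau v"
  using assms
proof (induction A arbitrary: u v rule: finite_linorder_max_induct)
  case (insert n A)
  let ?f = "filter (\<lambda>z. z < n)"
  have bound: "set w \<subseteq> {..n}" if "w \<in> lists (insert n A)" for w
    using that insert.hyps by (fastforce simp: less_imp_le)
  have f: "?f w \<in> lists A" if "w \<in> lists (insert n A)" for w
    using that by auto
  have shape: "lambda_shape (replicate m n @ w) = (m + count_list w n) # lambda_shape (?f w)"
    if "w \<in> lists (insert n A)" "length w < m" for w m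
  proof -
    have "length (top_row (P_tableau (?f w))) \<le> m"
      using that(2) length_top_row[of "?f w"] length_filter_le[of "\<lambda>z. z < n" w] by linarith
    then show ?thesis
      unfolding lambda_shape_def
      using that bound
      by (subst P_tableau_replicate_append)
        (use P_tableau_nonempty in \<open>auto intro!: shape_extend_columns P_tableau_column_strict\<close>)
  qed
  have "lambda_shape (y @ ?f u) = lambda_shape (y @ ?f v)" if "y \<in> lists A" for y
  proof -
    have y: "?f y = y" using that insert.hyps by (auto simp: filter_id_conv)
    \<comment> \<open>Large enough for \<open>shape\<close> to apply to \<open>y @ u\<close> and
      \<open>y @ v\<close> at once. Comparing tails then discards the first parts, which carry the
      multiplicities of \<open>n\<close>.\<close>
    define m where "m = Suc (length y + length u + length v)"
    have "lambda_shape (replicate m n @ y @ u) = lambda_shape (replicate m n @ y @ v)"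
      using insert.prems(3)[of "replicate m n @ y"] that by (metis append.assoc append_in_lists_conv in_lists_conv_set in_set_replicate insertCI)
    moreover have "y @ u \<in> lists (insert n A)" "y @ v \<in> lists (insert n A)"
      using that insert.prems by auto
    ultimately show ?thesis using shape[of "y @ u" m] shape[of "y @ v" m] y
      by (simp add: m_def)
  qed
  then have "P_tableau (?f u) = P_tableau (?f v)"
    using insert.prems f by (intro insert.IH) auto
  moreover have "lambda_shape u = lambda_shape v" using insert.prems(3)[of "[]"] by simp
  ultimately show ?case using P_tableau_eqI bound insert.prems by blast
qed simp

theorem theorem14p1:
  fixes A :: "'a::linorder set"
  assumes "finite A"
  shows "left_syntactic_congruence A lambda_shape = plactic_congruence A"
proof -
  have "P_tableau u = P_tableau v \<longleftrightarrow> (\<forall>x \<in> lists A. lambda_shape (x @ u) = lambda_shape (x @ v))"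
    if "u \<in> lists A" "v \<in> lists A" for u v
    using left_syntactic_P_tableau[OF assms that] P_tableau_append_left[of u v]
    by (auto simp: lambda_shape_def)
  then show ?thesis
    unfolding left_syntactic_congruence_def plactic_congruence_def by blast
qed

end
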